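(* Let $\boldsymbol{u}\in\mathcal{G}$. Then the map $L_{\boldsymbol{u}}:\mathcal{A}\to\mathcal{A}$ is bijective and $L_{\boldsymbol{u}}^{-1}=L_{\boldsymbol{v}}$, where $\boldsymbol{v}$ is the inverse of $\boldsymbol{u}$ in the abelian group $(\mathcal{G},\times)$. Moreover, $L_{\boldsymbol{u}}$ is a multiplier, i.e., $$L_{\boldsymbol{u}}(A\times C)(x)=(A\times L_{\boldsymbol{u}}C)(x)=(L_{\boldsymbol{u}}A\times C)(x),\qquad A(x),C(x)\in\mathcal{A}.$$
   Context: $\mathcal{G}$ is the set of real sequences $\boldsymbol{u}=(u_n)_{n\ge0}$ with $u_0\ne0$ and $\sum_{n\ge0}|u_n|r^n/n!<\infty$ for some $r>0$. The binomial convolution of $\boldsymbol{u},\boldsymbol{v}\in\mathcal{G}$ is $\boldsymbol{u}\times\boldsymbol{v}$ with $(u\times v)_n=\sum_{k=0}^n\binom{n}{k}u_kv_{n-k}$; $(\mathcal{G},\times)$ is an abelian group with identity $\boldsymbol{e}=(1,0,0,\dots)$. An Appell sequence is a sequence of real polynomials $A(x)=(A_n(x))_{n\ge0}$ with $A(0)=(A_n(0))_{n\ge0}\in\mathcal{G}$ and $A_n(x)=\sum_{k=0}^n\binom{n}{k}A_k(0)x^{n-k}$ for all $n\ge0$; $\mathcal{A}$ is the set of all Appell sequences. For $A(x),C(x)\in\mathcal{A}$ the binomial convolution $(A\times C)(x)=((A\times C)_n(x))_{n\ge0}\in\mathcal{A}$ is $(A\times C)_n(x)=\sum_{k=0}^n\binom{n}{k}A_k(0)C_{n-k}(x)$.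 The $k$th forward difference is $\Delta^kf(x)=\sum_{j=0}^k\binom{k}{j}(-1)^{k-j}f(x+j)$. For $\boldsymbol{u}\in\mathcal{G}$ and $A(x)\in\mathcal{A}$, $L_{\boldsymbol{u}}A(x)=(L_{\boldsymbol{u}}A_n(x))_{n\ge0}$ is defined by $L_{\boldsymbol{u}}A_n(x)=\sum_{k=0}^n\frac{u_k}{k!}\Delta^kA_n(x)$. *)

theory Defs
  imports "HOL-Analysis.Analysis" "HOL-Algebra.Group"
    "HOL-Computational_Algebra.Computational_Algebra"
begin

definition binom_conv :: "(nat \<Rightarrow> real) \<Rightarrow> (nat \<Rightarrow> real) \<Rightarrow> nat \<Rightarrow> real" where
  "binom_conv u v n = (\<Sum>k\<le>n. real (n choose k) * u k * v (n - k))"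

definition seq_group :: "(nat \<Rightarrow> real) monoid" where
  "seq_group =
    \<lparr>carrier = {u. u 0 \<noteq> 0 \<and> (\<exists>r>0. summable (\<lambda>n. \<bar>u n\<bar> * r ^ n / fact n))},
     monoid.mult = binom_conv,
     one = (\<lambda>n. if n = 0 then 1 else 0)\<rparr>"

definition appell_seqs :: "(nat \<Rightarrow> real poly) set" where
  "appell_seqs =
    {A. (\<lambda>n. poly (A n) 0) \<in> carrier seq_group \<and>
        (\<forall>n x. poly (A n) x = (\<Sum>k\<le>n. real (n choose k) * poly (A k) 0 * x ^ (n - k)))}"

definition appell_conv :: "(nat \<Rightarrow> real poly) \<Rightarrow> (nat \<Rightarrow> real poly) \<Rightarrow> nat \<Rightarrow> real poly" where
  "appell_conv A C n = (\<Sum>k\<le>n. smult (real (n choose k) * poly (A k) 0) (C (n - k)))"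

definition fwd_diff :: "nat \<Rightarrow> real poly \<Rightarrow> real poly" where
  "fwd_diff k f = (\<Sum>j\<le>k. smult (real (k choose j) * (-1) ^ (k - j)) (pcompose f [:real j, 1:]))"

lemma poly_fwd_diff:
  "poly (fwd_diff k f) x = (\<Sum>j\<le>k. real (k choose j) * (-1) ^ (k - j) * poly f (x + real j))"
  by (simp add: fwd_diff_def poly_sum poly_pcompose add.commute)

definition diff_op :: "(nat \<Rightarrow> real) \<Rightarrow> (nat \<Rightarrow> real poly) \<Rightarrow> nat \<Rightarrow> real poly" where
  "diff_op u A n = (\<Sum>k\<le>n. smult (u k / fact k) (fwd_diff k (A n)))"

text \<open>
  The inverse \<open>inv\<^bsub>seq_group\<^esub> u\<close> is meaningful because \<^const>\<open>seq_group\<close> is an abelian group.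
  This is proved through exponential generating functions with positive radius of convergence.
\<close>

definition egf :: "(nat \<Rightarrow> real) \<Rightarrow> real fps" where
  "egf u = Abs_fps (\<lambda>n. u n / fact n)"

lemma egf_inject: "egf u = egf v \<longleftrightarrow> u = v"
  by (auto simp: egf_def fps_eq_iff fun_eq_iff)

lemma egf_binom_conv: "egf (binom_conv u v) = egf u * egf v"
  by (auto simp: egf_def binom_conv_def fps_eq_iff fps_mult_nth atLeast0AtMost
      sum_divide_distrib binomial_fact field_simps intro!: sum.cong)

lemma egf_one: "egf (\<lambda>n. if n = 0 then 1 else 0) = 1"
  by (auto simp: egf_def fps_eq_iff)

lemma summable_egf_iff:
  "(\<exists>r>0. summable (\<lambda>n. \<bar>u n\<bar> * r ^ n / fact n)) \<longleftrightarrow> fps_conv_radius (egf u) > 0"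
proof
  assume "\<exists>r>0. summable (\<lambda>n. \<bar>u n\<bar> * r ^ n / fact n)"
  then obtain r where r: "r > 0" "summable (\<lambda>n. \<bar>u n\<bar> * r ^ n / fact n)" by blast
  have "summable (\<lambda>n. norm (u n / fact n * r ^ n))"
    using r by (simp add: abs_mult)
  then have "summable (\<lambda>n. u n / fact n * r ^ n)"
    by (rule summable_norm_cancel)
  then have "conv_radius (fps_nth (egf u)) \<ge> norm r"
    by (intro conv_radius_geI) (simp add: egf_def)
  with r(1) show "fps_conv_radius (egf u) > 0"
    by (simp add: fps_conv_radius_def) (metis ereal_less(2) less_le_trans)
next
  assume "fps_conv_radius (egf u) > 0"
  then obtain r where r: "0 < ereal r" "ereal r < fps_conv_radius (egf u)"
    using ereal_dense2 by blast
  then have "summable (\<lambda>n. norm (fps_nth (egf u) n * r ^ n))"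
    by (intro abs_summable_in_conv_radius) (simp add: fps_conv_radius_def)
  then show "\<exists>r>0. summable (\<lambda>n. \<bar>u n\<bar> * r ^ n / fact n)"
    using r(1) by (intro exI[of _ r]) (simp add: egf_def abs_mult)
qed

lemma carrier_seq_group_iff:
  "u \<in> carrier seq_group \<longleftrightarrow> fps_nth (egf u) 0 \<noteq> 0 \<and> fps_conv_radius (egf u) > 0"
  unfolding summable_egf_iff[symmetric] by (simp add: seq_group_def egf_def)

lemma egf_mult_seq_group: "egf (u \<otimes>\<^bsub>seq_group\<^esub> v) = egf u * egf v"
  by (simp add: seq_group_def egf_binom_conv)

lemma egf_one_seq_group: "egf \<one>\<^bsub>seq_group\<^esub> = 1"
  by (simp add: seq_group_def egf_one)

lemma comm_group_seq_group: "comm_group seq_group"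
proof (rule comm_groupI)
  show "u \<otimes>\<^bsub>seq_group\<^esub> v \<in> carrier seq_group"
    if "u \<in> carrier seq_group" "v \<in> carrier seq_group" for u v
  proof -
    have "min (fps_conv_radius (egf u)) (fps_conv_radius (egf v)) \<le> fps_conv_radius (egf u * egf v)"
      by (rule fps_conv_radius_mult)
    moreover have "0 < min (fps_conv_radius (egf u)) (fps_conv_radius (egf v))"
      using that by (simp add: carrier_seq_group_iff)
    ultimately have "0 < fps_conv_radius (egf u * egf v)"
      by (rule less_le_trans[rotated])
    then show ?thesis
      using that by (simp add: carrier_seq_group_iff egf_mult_seq_group)
  qed
  show "\<one>\<^bsub>seq_group\<^esub> \<in> carrier seq_group"
    by (simp add: carrier_seq_group_iff egf_one_seq_group)
  show "\<exists>v\<in>carrier seq_group. v \<otimes>\<^bsub>seq_group\<^esub> u = \<one>\<^bsub>seq_group\<^esub>"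
    if u: "u \<in> carrier seq_group" for u
  proof -
    define v where "v = (\<lambda>n. fact n * fps_nth (inverse (egf u)) n)"
    have v: "egf v = inverse (egf u)"
      by (simp add: v_def egf_def fps_eq_iff)
    have "v \<in> carrier seq_group"
      using u by (simp add: carrier_seq_group_iff v fps_conv_radius_inverse_pos)
    moreover have "egf (v \<otimes>\<^bsub>seq_group\<^esub> u) = egf \<one>\<^bsub>seq_group\<^esub>"
      using u by (simp add: carrier_seq_group_iff egf_mult_seq_group v egf_one_seq_group inverse_mult_eq_1)
    ultimately show ?thesis
      by (auto simp: egf_inject)
  qed
qed (simp_all add: egf_mult_seq_group egf_one_seq_group mult_ac flip: egf_inject)

end

theory Submission
  imports Defs
begin

text \<open>
  Everything is read off from exponential generating functions. For an Appell sequence \<open>A\<close> with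
  \<open>a = egf (A(0))\<close>, the defining formula says that the generating function of \<open>A(x)\<close> is
  \<open>a * exp(x X)\<close>. Shifting \<open>x\<close> by one multiplies this series by \<open>exp(X)\<close>, hence the \<open>k\<close>-th forward
  difference multiplies it by \<open>(exp(X) - 1)^k\<close>, and \<^term>\<open>diff_op u\<close> multiplies it by the
  fixed series \<open>egf u \<circ> (exp(X) - 1)\<close> (lemma \<open>appell_egf_diff_op\<close>). Truncating the sum at \<open>k = n\<close>
  loses nothing, because \<open>exp(X) - 1\<close> has no constant term.

  The binomial convolution \<open>A \<times> C\<close> likewise has generating function \<open>a * egf (C(x))\<close>,
  so the multiplier identities are associativity and commutativity of multiplication of power series.
  Composition with \<open>exp(X) - 1\<close> is a ring homomorphism; therefore the multipliers of a
  sequence and of its inverse in the group have product \<open>1\<close>, which yields the inverse map.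

  The only analytic point is that \<^term>\<open>diff_op u\<close> maps Appell sequences to Appell sequences: the
  multiplier must converge near the origin. That is the general fact that composing two
  power series with positive radius of convergence, the inner one without constant term, gives such a
  series again (lemma \<open>fps_conv_radius_compose_pos\<close>).
\<close>

section \<open>Convergence of composed power series\<close>

definition trunc_norm :: "nat \<Rightarrow> real \<Rightarrow> 'a::real_normed_field fps \<Rightarrow> real" where
  "trunc_norm N s f = (\<Sum>n\<le>N. norm (fps_nth f n) * s ^ n)"

lemma trunc_norm_nonneg: "s \<ge> 0 \<Longrightarrow> trunc_norm N s f \<ge> 0"
  by (simp add: trunc_norm_def sum_nonneg)

text \<open>
  As for the weighted \<open>\<ell>\<^sup>1\<close> norm, of which this is a truncation: the product of the two truncated
  sums contains all the terms that occur on the left and further nonnegative ones.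
\<close>

lemma trunc_norm_mult_le:
  assumes s: "s \<ge> 0"
  shows "trunc_norm N s (f * g) \<le> trunc_norm N s f * trunc_norm N s g"
proof -
  define h where "h = (\<lambda>i j. (norm (fps_nth f i) * s ^ i) * (norm (fps_nth g j) * s ^ j))"
  have "trunc_norm N s (f * g) \<le> (\<Sum>n\<le>N. \<Sum>i\<le>n. h i (n - i))"
    unfolding trunc_norm_def
  proof (rule sum_mono)
    fix n
    have "norm (fps_nth (f * g) n) * s ^ n
        \<le> (\<Sum>i\<le>n. norm (fps_nth f i * fps_nth g (n - i))) * s ^ n"
      using s by (intro mult_right_mono) (auto simp: fps_mult_nth atLeast0AtMost intro: norm_sum)
    also have "\<dots> = (\<Sum>i\<le>n. h i (n - i))"
      unfolding sum_distrib_right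
    proof (rule sum.cong[OF refl])
      fix i assume "i \<in> {..n}"
      then have "s ^ n = s ^ i * s ^ (n - i)"
        by (simp flip: power_add)
      then show "norm (fps_nth f i * fps_nth g (n - i)) * s ^ n = h i (n - i)"
        by (simp add: h_def norm_mult mult_ac)
    qed
    finally show "norm (fps_nth (f * g) n) * s ^ n \<le> (\<Sum>i\<le>n. h i (n - i))" .
  qed
  also have "\<dots> = (\<Sum>(i, j)\<in>{(i, j). i + j \<le> N}. h i j)"
    by (rule sum.triangle_reindex_eq[symmetric])
  also have "\<dots> \<le> (\<Sum>(i, j)\<in>{..N} \<times> {..N}. h i j)"
    using s by (intro sum_mono2) (auto simp: h_def)
  also have "\<dots> = trunc_norm N s f * trunc_norm N s g"
    by (simp add: trunc_norm_def h_def sum_product sum.cartesian_product)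
  finally show ?thesis .
qed

lemma trunc_norm_power_le:
  assumes s: "s \<ge> 0"
  shows "trunc_norm N s (f ^ k) \<le> trunc_norm N s f ^ k"
proof (induction k)
  case 0
  have "(\<Sum>n\<le>N. norm (fps_nth (1 :: 'a fps) n) * s ^ n) = (\<Sum>n\<le>N. if n = 0 then 1 else 0)"
    by (intro sum.cong) auto
  then show ?case by (simp add: trunc_norm_def)
next
  case (Suc k)
  have "trunc_norm N s (f ^ Suc k) \<le> trunc_norm N s f * trunc_norm N s (f ^ k)"
    using trunc_norm_mult_le[OF s, of N f "f ^ k"] by simp
  also have "\<dots> \<le> trunc_norm N s f * trunc_norm N s f ^ k"
    using Suc s by (intro mult_left_mono trunc_norm_nonneg)
  finally show ?case by simp
qed

text \<open>
  In \<open>f oo g = (\<Sum>k. f\<^sub>k g^k)\<close> each power \<open>g^k\<close> has norm at most \<open>r^k\<close>, so the composition is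
  dominated by the series of \<open>f\<close> with weight \<open>r\<close>.
\<close>

lemma trunc_norm_compose_le:
  assumes s: "s \<ge> 0" and g: "trunc_norm N s g \<le> r"
  shows "trunc_norm N s (f oo g) \<le> trunc_norm N r f"
proof -
  have "trunc_norm N s (f oo g)
      \<le> (\<Sum>n\<le>N. \<Sum>k\<le>N. norm (fps_nth f k) * norm (fps_nth (g ^ k) n) * s ^ n)"
    unfolding trunc_norm_def
  proof (rule sum_mono)
    fix n assume n: "n \<in> {..N}"
    have "norm (fps_nth (f oo g) n)
        \<le> (\<Sum>k\<le>n. norm (fps_nth f k * fps_nth (g ^ k) n))"
      unfolding fps_compose_nth atLeast0AtMost by (rule norm_sum)
    also have "\<dots> \<le> (\<Sum>k\<le>N. norm (fps_nth f k * fps_nth (g ^ k) n))"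
      using n by (intro sum_mono2) auto
    finally have "norm (fps_nth (f oo g) n) * s ^ n
        \<le> (\<Sum>k\<le>N. norm (fps_nth f k * fps_nth (g ^ k) n)) * s ^ n"
      using s by (intro mult_right_mono) auto
    then show "norm (fps_nth (f oo g) n) * s ^ n
        \<le> (\<Sum>k\<le>N. norm (fps_nth f k) * norm (fps_nth (g ^ k) n) * s ^ n)"
      by (simp add: sum_distrib_right norm_mult)
  qed
  also have "\<dots> = (\<Sum>k\<le>N. norm (fps_nth f k) * trunc_norm N s (g ^ k))"
    by (subst sum.swap) (simp add: trunc_norm_def sum_distrib_left mult_ac)
  also have "\<dots> \<le> (\<Sum>k\<le>N. norm (fps_nth f k) * r ^ k)"
  proof (intro sum_mono mult_left_mono)
    fix k
    have "trunc_norm N s (g ^ k) \<le> trunc_norm N s g ^ k"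
      by (rule trunc_norm_power_le[OF s])
    also have "\<dots> \<le> r ^ k"
      using g s by (intro power_mono trunc_norm_nonneg)
    finally show "trunc_norm N s (g ^ k) \<le> r ^ k" .
  qed auto
  finally show ?thesis by (simp add: trunc_norm_def)
qed

lemma trunc_norm_bounded:
  fixes f :: "'a::{banach, real_normed_field} fps"
  assumes "fps_conv_radius f > 0"
  obtains r B where "r > 0" "\<And>N. trunc_norm N r f \<le> B"
proof -
  obtain r where r: "0 < ereal r" "ereal r < fps_conv_radius f"
    using assms ereal_dense2 by blast
  have "summable (\<lambda>n. norm (fps_nth f n * of_real r ^ n))"
    using r by (intro abs_summable_in_conv_radius) (simp add: fps_conv_radius_def)
  then have sm: "summable (\<lambda>n. norm (fps_nth f n) * r ^ n)"
    using r(1) by (simp add: norm_mult norm_power)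
  have "trunc_norm N r f \<le> (\<Sum>n. norm (fps_nth f n) * r ^ n)" for N
    unfolding trunc_norm_def using r(1) by (intro sum_le_suminf sm) auto
  with r(1) show ?thesis by (intro that) auto
qed

text \<open>
  The terms of a series without constant term are all divisible by \<open>s\<close>, so the sum
  becomes arbitrarily small when the weight \<open>s\<close> shrinks. This is how the inner series is
  brought into the domain of convergence of the outer one.
\<close>

lemma trunc_norm_small:
  fixes g :: "'a::{banach, real_normed_field} fps"
  assumes "fps_conv_radius g > 0" and g0: "fps_nth g 0 = 0" and r: "r > 0"
  obtains s where "s > 0" "\<And>N. trunc_norm N s g \<le> r"
proof -
  obtain t B where t: "t > 0" and B: "\<And>N. trunc_norm N t g \<le> B"
    using trunc_norm_bounded[OF assms(1)] by metis
  have B0: "B \<ge> 0"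
    using B[of 0] trunc_norm_nonneg[of t 0 g] t by linarith
  define q where "q = min 1 (r / (B + 1))"
  have q: "q > 0" "q \<le> 1" "q * B \<le> r"
  proof -
    show "q > 0" "q \<le> 1" using r B0 by (auto simp: q_def)
    have "q * B \<le> r / (B + 1) * B"
      using B0 by (intro mult_right_mono) (auto simp: q_def)
    also have "\<dots> \<le> r"
      using r B0 by (simp add: field_simps)
    finally show "q * B \<le> r" .
  qed
  have "trunc_norm N (q * t) g \<le> r" for N
  proof -
    have "trunc_norm N (q * t) g \<le> (\<Sum>n\<le>N. q * (norm (fps_nth g n) * t ^ n))"
      unfolding trunc_norm_def
    proof (rule sum_mono)
      fix n
      show "norm (fps_nth g n) * (q * t) ^ n \<le> q * (norm (fps_nth g n) * t ^ n)"
      proof (cases n)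
        case (Suc m)
        have "q ^ n \<le> q"
          using q Suc power_le_one[of q m] by (simp add: mult_left_le)
        then have "q ^ n * (norm (fps_nth g n) * t ^ n) \<le> q * (norm (fps_nth g n) * t ^ n)"
          using t by (intro mult_right_mono) auto
        then show ?thesis by (simp add: power_mult_distrib mult_ac)
      qed (simp add: g0)
    qed
    also have "\<dots> = q * trunc_norm N t g"
      by (simp add: trunc_norm_def sum_distrib_left)
    also have "\<dots> \<le> q * B"
      using q B by (intro mult_left_mono) auto
    finally show ?thesis using q by linarith
  qed
  with q t show ?thesis by (intro that[of "q * t"]) auto
qed

lemma fps_conv_radius_compose_pos:
  fixes f g :: "'a::{banach, real_normed_field} fps"
  assumes f: "fps_conv_radius f > 0" and g: "fps_conv_radius g > 0" "fps_nth g 0 = 0"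
  shows "fps_conv_radius (f oo g) > 0"
proof -
  obtain r B where r: "r > 0" and B: "\<And>N. trunc_norm N r f \<le> B"
    using trunc_norm_bounded[OF f] by metis
  obtain s where s: "s > 0" and sr: "\<And>N. trunc_norm N s g \<le> r"
    using trunc_norm_small[OF g r] by metis
  have "trunc_norm N s (f oo g) \<le> B" for N
    using trunc_norm_compose_le[of s N g r f] sr[of N] B[of N] s by linarith
  then have "summable (\<lambda>n. norm (fps_nth (f oo g) n) * s ^ n)"
    using s by (intro bounded_imp_summable[where B = B]) (auto simp: trunc_norm_def)
  then have "summable (\<lambda>n. norm (fps_nth (f oo g) n * of_real s ^ n))"
    using s by (simp add: norm_mult norm_power)
  then have "summable (\<lambda>n. fps_nth (f oo g) n * of_real s ^ n)"
    by (rule summable_norm_cancel)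
  then have "conv_radius (fps_nth (f oo g)) \<ge> norm (of_real s :: 'a)"
    by (rule conv_radius_geI)
  moreover have "ereal (norm (of_real s :: 'a)) > 0"
    using s by simp
  ultimately show ?thesis
    unfolding fps_conv_radius_def by (rule less_le_trans[rotated])
qed

section \<open>Generating functions of Appell sequences\<close>

definition appell_egf :: "(nat \<Rightarrow> real poly) \<Rightarrow> real \<Rightarrow> real fps" where
  "appell_egf A x = egf (\<lambda>n. poly (A n) x)"

lemma appell_egf_eqI:
  assumes "\<And>x. appell_egf A x = appell_egf B x"
  shows "A = B"
proof
  fix n
  have "poly (A n) x = poly (B n) x" for x
    using assms[of x] unfolding appell_egf_def egf_inject by (rule fun_cong)
  then show "A n = B n"
    by (intro iffD1[OF poly_eq_poly_eq_iff] ext)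
qed

lemma egf_powers: "egf (\<lambda>n. x ^ n) = fps_exp x"
  by (simp add: egf_def fps_eq_iff)

lemma appell_seqs_iff:
  "A \<in> appell_seqs \<longleftrightarrow> fps_nth (appell_egf A 0) 0 \<noteq> 0 \<and> fps_conv_radius (appell_egf A 0) > 0 \<and>
    (\<forall>x. appell_egf A x = appell_egf A 0 * fps_exp x)"
proof -
  have "(\<forall>n x. poly (A n) x = (\<Sum>k\<le>n. real (n choose k) * poly (A k) 0 * x ^ (n - k)))
    \<longleftrightarrow> (\<forall>x. (\<lambda>n. poly (A n) x) = binom_conv (\<lambda>n. poly (A n) 0) (\<lambda>n. x ^ n))"
    by (auto simp: fun_eq_iff binom_conv_def)
  also have "\<dots> \<longleftrightarrow> (\<forall>x. appell_egf A x = appell_egf A 0 * fps_exp x)"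
    by (simp add: appell_egf_def egf_binom_conv egf_powers flip: egf_inject)
  finally show ?thesis
    by (simp add: appell_seqs_def carrier_seq_group_iff appell_egf_def)
qed

lemma appell_seqsD:
  assumes "A \<in> appell_seqs"
  shows "fps_nth (appell_egf A 0) 0 \<noteq> 0" "fps_conv_radius (appell_egf A 0) > 0"
    "appell_egf A x = appell_egf A 0 * fps_exp x"
  using assms unfolding appell_seqs_iff by blast+

text \<open>
  Multiplying the generating function by a convergent invertible series that does not depend on \<open>x\<close>
  stays within Appell sequences. Both \<^term>\<open>diff_op u\<close> and convolution with an Appell
  sequence act in this way.
\<close>

lemma appell_seqs_multI:
  assumes A: "A \<in> appell_seqs" and F: "fps_nth F 0 \<noteq> 0" "fps_conv_radius F > 0"
    and B: "\<And>x. appell_egf B x = appell_egf A x * F"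
  shows "B \<in> appell_seqs"
  unfolding appell_seqs_iff
proof (intro conjI allI)
  show "fps_nth (appell_egf B 0) 0 \<noteq> 0"
    using F appell_seqsD(1)[OF A] by (simp add: B)
  have "min (fps_conv_radius (appell_egf A 0)) (fps_conv_radius F) > 0"
    using F appell_seqsD(2)[OF A] by simp
  also have "\<dots> \<le> fps_conv_radius (appell_egf B 0)"
    unfolding B by (rule fps_conv_radius_mult)
  finally show "fps_conv_radius (appell_egf B 0) > 0" .
  show "appell_egf B x = appell_egf B 0 * fps_exp x" for x
    unfolding B appell_seqsD(3)[OF A, of x] by (simp only: mult_ac)
qed

lemma appell_egf_shift:
  assumes "A \<in> appell_seqs"
  shows "appell_egf A (x + real j) = appell_egf A x * fps_exp 1 ^ j"
  unfolding appell_seqsD(3)[OF assms, of x] appell_seqsD(3)[OF assms, of "x + real j"]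
  by (simp add: fps_exp_add_mult fps_exp_power_mult mult.assoc)

lemma appell_egf_appell_conv: "appell_egf (appell_conv A C) x = appell_egf A 0 * appell_egf C x"
  unfolding appell_egf_def egf_binom_conv[symmetric]
  by (simp add: appell_conv_def binom_conv_def[abs_def] poly_sum)

text \<open>
  The forward difference is the \<open>k\<close>-th power of the shift minus the identity, and the shift acts as
  multiplication by \<open>exp(X)\<close>; so this is the binomial theorem.
\<close>

lemma appell_egf_fwd_diff:
  assumes "A \<in> appell_seqs"
  shows "appell_egf (\<lambda>n. fwd_diff k (A n)) x = appell_egf A x * (fps_exp 1 - 1) ^ k"
proof -
  have "appell_egf (\<lambda>n. fwd_diff k (A n)) x
      = (\<Sum>j\<le>k. fps_const (real (k choose j) * (-1) ^ (k - j)) * appell_egf A (x + real j))"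
    by (simp add: fps_eq_iff appell_egf_def egf_def poly_fwd_diff fps_sum_nth sum_divide_distrib)
  also have "\<dots> = appell_egf A x *
      (\<Sum>j\<le>k. of_nat (k choose j) * fps_exp 1 ^ j * (-1) ^ (k - j))"
    unfolding sum_distrib_left
  proof (rule sum.cong[OF refl])
    fix j
    have "fps_const (real (k choose j) * (-1) ^ (k - j))
        = of_nat (k choose j) * (-1 :: real fps) ^ (k - j)"
      by (simp add: fps_of_nat flip: fps_const_mult fps_const_1_eq_1)
    then show "fps_const (real (k choose j) * (-1) ^ (k - j)) * appell_egf A (x + real j)
        = appell_egf A x * (of_nat (k choose j) * fps_exp 1 ^ j * (-1) ^ (k - j))"
      by (simp only: appell_egf_shift[OF assms] mult_ac)
  qed
  also have "\<dots> = appell_egf A x * (fps_exp 1 + (- 1)) ^ k"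
    by (simp only: binomial_ring)
  finally show ?thesis by simp
qed

definition diff_op_multiplier :: "(nat \<Rightarrow> real) \<Rightarrow> real fps" where
  "diff_op_multiplier u = egf u oo (fps_exp 1 - 1)"

text \<open>
  By the formula for forward differences, the left-hand side at \<open>x\<close> is the generating function of
  \<open>A(x)\<close> times \<open>\<Sum>k. (u k / k!) (exp(X) - 1)^k\<close>, which is the composition. The proof compares
  coefficients, where all sums are finite.
\<close>

lemma appell_egf_diff_op:
  assumes A: "A \<in> appell_seqs"
  shows "appell_egf (diff_op u A) x = appell_egf A x * diff_op_multiplier u"
proof (rule fps_ext)
  fix n
  let ?a = "fps_nth (appell_egf A x)" and ?d = "fps_exp 1 - 1 :: real fps"
  have extend: "fps_nth (diff_op_multiplier u) m = (\<Sum>k\<le>n. u k / fact k * fps_nth (?d ^ k) m)"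
    if "m \<le> n" for m
  proof -
    \<comment> \<open>The powers of \<open>exp(X) - 1\<close> beyond the \<open>m\<close>-th have no coefficient at \<open>m\<close>.\<close>
    have "fps_nth (?d ^ k) m = 0" if "m < k" for k
      using startsby_zero_power_prefix[of ?d k] that by simp
    then show ?thesis
      using that unfolding diff_op_multiplier_def fps_compose_nth atLeast0AtMost
      by (intro sum.mono_neutral_cong_left) (auto simp: egf_def)
  qed
  have "fps_nth (appell_egf (diff_op u A) x) n
      = (\<Sum>k\<le>n. u k / fact k * fps_nth (appell_egf (\<lambda>n. fwd_diff k (A n)) x) n)"
    by (simp add: appell_egf_def egf_def diff_op_def poly_sum sum_divide_distrib)
  also have "\<dots> = (\<Sum>k\<le>n. \<Sum>i\<le>n. u k / fact k * (?a i * fps_nth (?d ^ k) (n - i)))"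
    by (simp add: appell_egf_fwd_diff[OF A] fps_mult_nth atLeast0AtMost sum_distrib_left)
  also have "\<dots> = (\<Sum>i\<le>n. ?a i * fps_nth (diff_op_multiplier u) (n - i))"
    by (subst sum.swap) (simp add: extend sum_distrib_left mult_ac)
  also have "\<dots> = fps_nth (appell_egf A x * diff_op_multiplier u) n"
    by (simp add: fps_mult_nth atLeast0AtMost)
  finally show "fps_nth (appell_egf (diff_op u A) x) n
    = fps_nth (appell_egf A x * diff_op_multiplier u) n" .
qed

text \<open>Composition with \<open>exp(X) - 1\<close> preserves the product \<open>egf u * egf (inv u) = 1\<close>.\<close>

lemma diff_op_multiplier_inv:
  assumes u: "u \<in> carrier seq_group"
  shows "diff_op_multiplier u * diff_op_multiplier (inv\<^bsub>seq_group\<^esub> u) = 1"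
proof -
  interpret comm_group seq_group by (rule comm_group_seq_group)
  have "egf u * egf (inv\<^bsub>seq_group\<^esub> u) = 1"
    using u by (simp flip: egf_mult_seq_group add: egf_one_seq_group)
  then show ?thesis
    by (simp add: diff_op_multiplier_def flip: fps_compose_mult_distrib)
qed

section \<open>The operators on Appell sequences\<close>

lemma diff_op_appell_seqs:
  assumes u: "u \<in> carrier seq_group" and A: "A \<in> appell_seqs"
  shows "diff_op u A \<in> appell_seqs"
proof (rule appell_seqs_multI[OF A])
  show "appell_egf (diff_op u A) x = appell_egf A x * diff_op_multiplier u" for x
    by (rule appell_egf_diff_op[OF A])
  show "fps_nth (diff_op_multiplier u) 0 \<noteq> 0"
    using u by (simp add: diff_op_multiplier_def carrier_seq_group_iff)
  show "fps_conv_radius (diff_op_multiplier u) > 0"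
    unfolding diff_op_multiplier_def
  proof (rule fps_conv_radius_compose_pos)
    show "fps_conv_radius (fps_exp 1 - 1 :: real fps) > 0"
      using fps_conv_radius_diff[of "fps_exp 1 :: real fps" 1] by simp
  qed (use u in \<open>simp_all add: carrier_seq_group_iff\<close>)
qed

lemma appell_conv_appell_seqs:
  assumes A: "A \<in> appell_seqs" and C: "C \<in> appell_seqs"
  shows "appell_conv A C \<in> appell_seqs"
  by (rule appell_seqs_multI[OF C appell_seqsD(1,2)[OF A]])
    (simp add: appell_egf_appell_conv mult.commute)

lemma diff_op_diff_op_inverse:
  assumes "u \<in> carrier seq_group" "v \<in> carrier seq_group" "A \<in> appell_seqs"
    and "diff_op_multiplier u * diff_op_multiplier v = 1"
  shows "diff_op v (diff_op u A) = A"
  using assms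
  by (intro appell_egf_eqI) (simp add: appell_egf_diff_op diff_op_appell_seqs mult.assoc)

lemma diff_op_appell_conv_right:
  assumes "A \<in> appell_seqs" "C \<in> appell_seqs"
  shows "diff_op u (appell_conv A C) = appell_conv A (diff_op u C)"
  using assms
  by (intro appell_egf_eqI)
    (simp add: appell_egf_diff_op appell_egf_appell_conv appell_conv_appell_seqs mult.assoc)

lemma appell_conv_diff_op_swap:
  assumes "A \<in> appell_seqs" "C \<in> appell_seqs"
  shows "appell_conv A (diff_op u C) = appell_conv (diff_op u A) C"
  using assms
  by (intro appell_egf_eqI) (simp add: appell_egf_diff_op appell_egf_appell_conv mult_ac)

theorem corollary2:
  fixes u :: "nat \<Rightarrow> real"
  assumes "u \<in> carrier seq_group"
  shows "bij_betw (diff_op u) appell_seqs appell_seqs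
    \<and> (\<forall>A\<in>appell_seqs. inv_into appell_seqs (diff_op u) A = diff_op (inv\<^bsub>seq_group\<^esub> u) A)
    \<and> (\<forall>A\<in>appell_seqs. \<forall>C\<in>appell_seqs.
          diff_op u (appell_conv A C) = appell_conv A (diff_op u C)
          \<and> appell_conv A (diff_op u C) = appell_conv (diff_op u A) C)"
proof -
  interpret comm_group seq_group by (rule comm_group_seq_group)
  let ?v = "inv\<^bsub>seq_group\<^esub> u"
  have v: "?v \<in> carrier seq_group"
    using assms by simp
  have vu: "diff_op ?v (diff_op u A) = A" and uv: "diff_op u (diff_op ?v A) = A"
    if "A \<in> appell_seqs" for A
    using that assms v diff_op_multiplier_inv[OF assms]
    by (simp_all add: diff_op_diff_op_inverse mult.commute)
  have bij: "bij_betw (diff_op u) appell_seqs appell_seqs"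
    by (rule bij_betwI[where g = "diff_op ?v"])
      (use assms v vu uv in \<open>auto intro: diff_op_appell_seqs\<close>)
  moreover have "inv_into appell_seqs (diff_op u) A = diff_op ?v A" if "A \<in> appell_seqs" for A
    using bij that v uv by (intro inv_into_f_eq) (auto simp: bij_betw_def diff_op_appell_seqs)
  ultimately show ?thesis
    by (simp add: diff_op_appell_conv_right appell_conv_diff_op_swap)
qed

end
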